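(* Let $A$ be an $n\times n$ matrix. Let $3\le k\le n$, and suppose Dodgson's method applied to $A$ has produced $A^{(n)}=A,\dots,A^{(k)}$ without division by zero. Suppose the interior of $A^{(k)}$ contains a zero in row $i$ and column $j$ of $A^{(k)}$, where $2\le i,j\le k-1$. Suppose further that the element $\alpha=A^{(k)}_{i-1,j}$ is non-zero. Let $\ell=n-k$. Let $\mathcal{A}$ be the $(\ell+3)\times(\ell+3)$ submatrix of $A$ whose upper left corner is the entry in row $i-1$ and column $j-1$ of $A$, i.e. $\mathcal{A}=A_{i-1\ldots i+\ell+1,\;j-1\ldots j+\ell+1}$. Cross out from $\mathcal{A}$ the $(\ell+1)\times(\ell+1)$ submatrix occupying rows $1,\dots,\ell+1$ and columns $2,\dots,\ell+2$ of $\mathcal{A}$. This crossing out leaves the $2\times2$ complementary matrix $M^*$, occupying rows $\ell+2,\ell+3$ and columns $1,\ell+3$ of $\mathcal{A}$. Let $M'$ be the $2\times 2$ matrix whose entry in each position is the minor in $\mathcal{A}$ of the corresponding element of $M^*$. Here the minor of the element in row $p$ and column $q$ of $\mathcal{A}$ is the determinant of $\mathcal{A}$ with row $p$ and column $q$ deleted. Then the element in row $i-1$ and column $j-1$ of $A^{(k-2)}$ can be computed as $\det M'/\alpha$. That is, \[ \frac{\det M'}{\alpha}=\det\mathcal{A}=\det A_{i-1\ldots i+\ell+1,\;j-1\ldots j+\ell+1}, \] which is the value that entry has in a successful run of Dodgson's method.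
   Context: Notation: $A_{i\ldots j,\,k\ldots \ell}$ denotes the submatrix formed by rows $i,\dots,j$ and columns $k,\dots,\ell$ of $A$. The interior of an $m\times m$ matrix $X$ is the $(m-1)\times(m-1)$ matrix with $(p,q)$ entry $X_{p+1,q+1}$; an entry of $X$ is "in the interior" if it lies in rows $2,\dots,m-1$ and columns $2,\dots,m-1$. Dodgson's method for an $n\times n$ matrix $A$: set $A^{(n)}=A$. For $m=n-1,\dots,1$, let $B^{(m)}_{p,q}=A^{(m+1)}_{p,q}A^{(m+1)}_{p+1,q+1}-A^{(m+1)}_{p+1,q}A^{(m+1)}_{p,q+1}$ for $1\le p,q\le m$. Set $A^{(n-1)}=B^{(n-1)}$. For $m\le n-2$, set $A^{(m)}_{p,q}=B^{(m)}_{p,q}/A^{(m+2)}_{p+1,q+1}$. The method fails if one of these divisors is zero. When all steps succeed, $A^{(m)}_{p,q}=\det A_{p\ldots p+n-m,\;q\ldots q+n-m}$. In particular $A^{(k)}_{i-1,j}=\det A_{i-1\ldots i-1+\ell,\;j\ldots j+\ell}$ with $\ell=n-k$. *)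

theory Defs
  imports "Jordan_Normal_Form.Determinant" "Jordan_Normal_Form.DL_Submatrix"
begin

text \<open>
  Matrix entries are indexed from 0, as in the library: the entry in row \<open>p\<close> and column \<open>q\<close>
  of \<open>X\<close>, counted from 1, is \<open>X $$ (p - 1, q - 1)\<close>.
\<close>

definition interior_mat :: "'a mat \<Rightarrow> 'a mat" where
  "interior_mat X = mat (dim_row X - 2) (dim_col X - 2) (\<lambda>(p, q). X $$ (p + 1, q + 1))"

definition consecutive_minors :: "'a::comm_ring_1 mat \<Rightarrow> 'a mat" where
  "consecutive_minors X = mat (dim_row X - 1) (dim_col X - 1)
     (\<lambda>(p, q). X $$ (p, q) * X $$ (p + 1, q + 1) - X $$ (p + 1, q) * X $$ (p, q + 1))"

definition entrywise_divide :: "'a::field mat \<Rightarrow> 'a mat \<Rightarrow> 'a mat" where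
  "entrywise_divide X Y = mat (dim_row X) (dim_col X) (\<lambda>(p, q). X $$ (p, q) / Y $$ (p, q))"

text \<open>
  \<open>dodgson_step A s\<close> is the matrix obtained from the \<open>n \<times> n\<close> matrix \<open>A\<close> after \<open>s\<close> condensations;
  it has size \<open>n - s\<close>, and \<open>dodgson A m\<close> is the one of size \<open>m \<le> n\<close>, written $A^{(m)}$ in the
  mathematical notation. Both are total functions because \<open>x / 0 = 0\<close>; their values are those
  of the method only as far as \<open>dodgson_produces\<close> holds.
\<close>

fun dodgson_step :: "'a::field mat \<Rightarrow> nat \<Rightarrow> 'a mat" where
  "dodgson_step A 0 = A"
| "dodgson_step A (Suc 0) = consecutive_minors A"
| "dodgson_step A (Suc (Suc s)) =
     entrywise_divide (consecutive_minors (dodgson_step A (Suc s))) (interior_mat (dodgson_step A s))"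

definition dodgson :: "'a::field mat \<Rightarrow> nat \<Rightarrow> 'a mat" where
  "dodgson A m = dodgson_step A (dim_row A - m)"

text \<open>
  The method produces $A^{(n)}, \ldots, A^{(k)}$ without division by zero: the divisors used
  for $A^{(m)}$, \<open>m \<le> n - 2\<close>, are the entries of the interior of $A^{(m+2)}$.
\<close>

definition dodgson_produces :: "'a::field mat \<Rightarrow> nat \<Rightarrow> bool" where
  "dodgson_produces A k \<longleftrightarrow>
     (\<forall>m. k \<le> m \<and> m + 2 \<le> dim_row A \<longrightarrow>
        (\<forall>p<m. \<forall>q<m. interior_mat (dodgson A (m + 2)) $$ (p, q) \<noteq> 0))"

text \<open>The minor of the entry at position \<open>(p, q)\<close>, without the cofactor sign.\<close>

definition entry_minor :: "'a::comm_ring_1 mat \<Rightarrow> nat \<Rightarrow> nat \<Rightarrow> 'a" where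
  "entry_minor X p q = det (mat_delete X p q)"

end

theory Submission
  imports Defs
begin

text \<open>
  Everything rests on the Desnanot-Jacobi identity for an arbitrary pair of rows and an arbitrary pair
  of columns. For the outer rows and columns it is Dodgson's recurrence, so that the entries of the
  condensed matrices are connected minors as long as no divisor vanishes. For the last two rows and the
  outer columns of \<open>\<A>\<close>, the complementary minor is \<open>\<alpha>\<close> instead of the vanishing central minor.
  The identity comes from Cramer's rule for a matrix in which one column has been replaced by a unit
  vector, the vector of unknowns being a row of cofactors of the original matrix. As this never divides
  by the determinant, singular matrices need no separate treatment.
\<close>

section \<open>Column replacement, cofactors and the Desnanot-Jacobi identity\<close>

lemma replace_col_carrier [simp]:
  "A \<in> carrier_mat n m \<Longrightarrow> replace_col A b k \<in> carrier_mat n m"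
  by (auto simp: replace_col_def)

text \<open>Laplace expansion along column \<open>k\<close>: the cofactors of that column do not see
  its entries, so they remain those of \<open>A\<close>.\<close>

lemma det_replace_col:
  assumes A: "A \<in> carrier_mat n n" and k: "k < n"
  shows "det (replace_col A b k) = (\<Sum>i<n. b $ i * cofactor A i k)"
proof -
  have "mat_delete (replace_col A b k) i k = mat_delete A i k" for i
    using A by (auto simp: mat_delete_def replace_col_def intro!: eq_matI)
  moreover have "replace_col A b k $$ (i, k) = b $ i" if "i < n" for i
    using A k that by (simp add: replace_col_def)
  ultimately show ?thesis
    using laplace_expansion_column[OF replace_col_carrier[OF A] k, of b k]
    by (simp add: cofactor_def)
qed

lemma det_replace_col_unit_vec:
  assumes "A \<in> carrier_mat n n" and "k < n" and "r < n"
  shows "det (replace_col A (unit_vec n r) k) = cofactor A r k"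
proof -
  have "unit_vec n r $ i * cofactor A i k = (if i = r then cofactor A i k else 0)" if "i < n" for i
    using that assms by simp
  then show ?thesis
    using assms by (simp add: det_replace_col)
qed

text \<open>The cofactors of row \<open>r\<close> form column \<open>r\<close> of the adjugate, so
  this is one column of the product of \<open>A\<close> with its adjugate.\<close>

lemma mult_mat_vec_cofactors:
  assumes A: "A \<in> carrier_mat n n" and r: "r < n"
  shows "A *\<^sub>v vec n (cofactor A r) = det A \<cdot>\<^sub>v unit_vec n r"
proof -
  have "vec n (cofactor A r) = col (adj_mat A) r"
    using A r by (auto simp: adj_mat_def)
  then have "A *\<^sub>v vec n (cofactor A r) = col (A * adj_mat A) r"
    using A r adj_mat(1)[OF A] by auto
  then show ?thesis
    using r by (auto simp: adj_mat(2)[OF A])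
qed

text \<open>The signed form of Desnanot-Jacobi. Put the product of \<open>B\<close> and
  \<open>w\<close> into column \<open>d\<close> of \<open>B\<close>: Cramer's rule and expansion
  along \<open>d\<close> give two values for the determinant.\<close>

lemma det_mult_cofactor_replace_col:
  assumes A: "A \<in> carrier_mat n n"
    and r: "r < n" and s: "s < n" and c: "c < n" and d: "d < n" and cd: "c \<noteq> d"
  shows "det A * cofactor (replace_col A (unit_vec n r) c) s d
    = cofactor A r c * cofactor A s d - cofactor A r d * cofactor A s c"
proof -
  define B where "B = replace_col A (unit_vec n r) c"
  define w where "w = vec n (cofactor A s)"
  define e where "e = (\<lambda>t i. unit_vec n t $ i :: 'a)"
  have B: "B \<in> carrier_mat n n" using A by (simp add: B_def)
  have w: "w \<in> carrier_vec n" by (simp add: w_def)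
  \<comment> \<open>\<open>B\<close> and \<open>A\<close> differ in column \<open>c\<close> only, so
    the product of \<open>A\<close> and \<open>w\<close> needs a correction by \<open>w $ c\<close>
    times the difference of these columns.\<close>
  have Bw: "(B *\<^sub>v w) $ i = det A * e s i + w $ c * (e r i - A $$ (i, c))"
    if i: "i < n" for i
  proof -
    have "(\<Sum>j<n. A $$ (i, j) * w $ j) = det A * e s i"
    proof -
      have "(A *\<^sub>v w) $ i = det A * e s i"
        unfolding w_def mult_mat_vec_cofactors[OF A s] e_def using i by simp
      then show ?thesis
        using A i w by (simp add: scalar_prod_def lessThan_atLeast0)
    qed
    moreover have "(B *\<^sub>v w) $ i
        = (\<Sum>j<n. A $$ (i, j) * w $ j + (if j = c then w $ c * (e r i - A $$ (i, c)) else 0))"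
      using A i w c
      by (auto simp: B_def replace_col_def scalar_prod_def lessThan_atLeast0 e_def algebra_simps
          intro!: sum.cong)
    ultimately show ?thesis
      using c by (simp add: sum.distrib)
  qed
  have unit: "(\<Sum>i<n. e t i * cofactor B i d) = cofactor B t d" if "t < n" for t
    using det_replace_col[OF B d, of "unit_vec n t"] det_replace_col_unit_vec[OF B d that]
    by (simp add: e_def)
  \<comment> \<open>As a determinant, this cofactor has the same unit vector in columns
    \<open>c\<close> and \<open>d\<close>.\<close>
  have r0: "cofactor B r d = 0"
  proof -
    have "det (replace_col B (unit_vec n r) d) = 0"
    proof (rule det_identical_columns[OF _ cd c d])
      show "col (replace_col B (unit_vec n r) d) c = col (replace_col B (unit_vec n r) d) d"
        using A c d by (auto simp: B_def replace_col_def)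
    qed (simp add: B)
    then show ?thesis
      using det_replace_col_unit_vec[OF B d r] by simp
  qed
  \<comment> \<open>Column \<open>d\<close> now holds column \<open>c\<close> of \<open>A\<close>,
    and column \<open>c\<close> holds the unit vector; exchanging the two costs a sign.\<close>
  have swap: "(\<Sum>i<n. A $$ (i, c) * cofactor B i d) = - cofactor A r d"
  proof -
    have "replace_col B (col A c) d = swapcols c d (replace_col A (unit_vec n r) d)"
      using A c d cd by (auto simp: B_def replace_col_def mat_swapcols_def intro!: eq_matI)
    then have "det (replace_col B (col A c) d) = - cofactor A r d"
      using det_swapcols[OF c d cd, of "replace_col A (unit_vec n r) d"]
        det_replace_col_unit_vec[OF A d r] A by simp
    moreover have "col A c $ i = A $$ (i, c)" if "i < n" for i
      using A c that by simp
    ultimately show ?thesis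
      using det_replace_col[OF B d, of "col A c"] by simp
  qed
  have "w $ d * det B = det (replace_col B (B *\<^sub>v w) d)"
    using cramer_lemma_mat[OF B w d] by simp
  also have "\<dots> = (\<Sum>i<n. (B *\<^sub>v w) $ i * cofactor B i d)"
    by (rule det_replace_col[OF B d])
  also have "\<dots> = (\<Sum>i<n. det A * (e s i * cofactor B i d) + w $ c * (e r i * cofactor B i d)
      - w $ c * (A $$ (i, c) * cofactor B i d))"
    by (intro sum.cong refl) (simp add: Bw algebra_simps del: index_mult_mat_vec)
  also have "\<dots> = det A * cofactor B s d + w $ c * cofactor A r d"
    by (simp add: sum.distrib sum_subtractf sum_distrib_left[symmetric] unit r s r0 swap)
  finally show ?thesis
    using c d det_replace_col_unit_vec[OF A c r] unfolding B_def w_def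
    by (simp add: algebra_simps)
qed

text \<open>Since \<open>r < s\<close> and \<open>c < d\<close>, deleting row \<open>s\<close> and
  column \<open>d\<close> first leaves the indices \<open>r\<close> and \<open>c\<close> valid. All
  terms then carry the same sign, which cancels.\<close>

lemma desnanot_jacobi:
  assumes A: "A \<in> carrier_mat n n" and r: "r < s" "s < n" and c: "c < d" "d < n"
  shows "det A * det (mat_delete (mat_delete A s d) r c)
    = det (mat_delete A r c) * det (mat_delete A s d)
      - det (mat_delete A r d) * det (mat_delete A s c)"
proof -
  let ?B = "replace_col A (unit_vec n r) c"
  have "mat_delete ?B s d = replace_col (mat_delete A s d) (unit_vec (n - 1) r) c"
    using A r c by (auto simp: mat_delete_def replace_col_def intro!: eq_matI)
  moreover have "mat_delete A s d \<in> carrier_mat (n - 1) (n - 1)"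
    using A by (rule mat_delete_carrier)
  ultimately have "cofactor ?B s d
      = (-1) ^ (s + d) * ((-1) ^ (r + c) * det (mat_delete (mat_delete A s d) r c))"
    using det_replace_col_unit_vec[of "mat_delete A s d" "n - 1" c r] r c
    by (simp add: cofactor_def)
  then have "(-1) ^ (r + c + s + d) * (det A * det (mat_delete (mat_delete A s d) r c))
    = (-1) ^ (r + c + s + d) * (det (mat_delete A r c) * det (mat_delete A s d)
      - det (mat_delete A r d) * det (mat_delete A s c))"
    using det_mult_cofactor_replace_col[OF A, of r s c d] r c
    by (simp add: cofactor_def power_add algebra_simps)
  then show ?thesis
    by (cases "even (r + c + s + d)") (simp_all only: power_minus_even power_minus_odd
        power_one mult_1_left mult_minus_left neg_equal_iff_equal simp_thms)
qed

section \<open>Contiguous blocks and Dodgson's recurrence for their minors\<close>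

definition block :: "'a mat \<Rightarrow> nat \<Rightarrow> nat \<Rightarrow> nat \<Rightarrow> 'a mat" where
  "block A p q m = mat m m (\<lambda>(a, b). A $$ (p + a, q + b))"

lemma block_carrier [simp]: "block A p q m \<in> carrier_mat m m"
  and dim_row_block [simp]: "dim_row (block A p q m) = m"
  and dim_col_block [simp]: "dim_col (block A p q m) = m"
  by (simp_all add: block_def)

lemma submatrix_eq_block:
  assumes "p + m \<le> dim_row A" and "q + m \<le> dim_col A"
  shows "submatrix A {p..<p + m} {q..<q + m} = block A p q m"
proof (rule eq_matI)
  have "{i. i < dim_row A \<and> i \<in> {p..<p + m}} = {p..<p + m}"
    and "{i. i < dim_col A \<and> i \<in> {q..<q + m}} = {q..<q + m}"
    using assms by auto
  then show "dim_row (submatrix A {p..<p + m} {q..<q + m}) = dim_row (block A p q m)"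
    and "dim_col (submatrix A {p..<p + m} {q..<q + m}) = dim_col (block A p q m)"
    by (simp_all add: dim_submatrix)
next
  fix a b
  assume "a < dim_row (block A p q m)" "b < dim_col (block A p q m)"
  then have ab: "a < m" "b < m" by simp_all
  have "{x \<in> {p..<p + m}. x < p + a} = {p..<p + a}" "{x \<in> {q..<q + m}. x < q + b} = {q..<q + b}"
    using ab by auto
  then show "submatrix A {p..<p + m} {q..<q + m} $$ (a, b) = block A p q m $$ (a, b)"
    using submatrix_index_card[of "p + a" A "q + b" "{p..<p + m}" "{q..<q + m}"] ab assms
    by (simp add: block_def)
qed

lemma mat_delete_block:
  "mat_delete (block A p q (Suc m)) 0 0 = block A (Suc p) (Suc q) m"
  "mat_delete (block A p q (Suc m)) 0 m = block A (Suc p) q m"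
  "mat_delete (block A p q (Suc m)) m 0 = block A p (Suc q) m"
  "mat_delete (block A p q (Suc m)) m m = block A p q m"
  by (rule eq_matI; simp add: mat_delete_def block_def)+

text \<open>Desnanot-Jacobi for the outermost rows and columns. The case \<open>m = 0\<close> is
  included, with an empty central block.\<close>

lemma dodgson_condensation:
  "det (block A p q (Suc (Suc m))) * det (block A (Suc p) (Suc q) m)
    = det (block A p q (Suc m)) * det (block A (Suc p) (Suc q) (Suc m))
      - det (block A (Suc p) q (Suc m)) * det (block A p (Suc q) (Suc m))"
proof -
  let ?X = "block A p q (Suc (Suc m))"
  have "det ?X * det (mat_delete (mat_delete ?X (Suc m) (Suc m)) 0 0)
    = det (mat_delete ?X 0 0) * det (mat_delete ?X (Suc m) (Suc m))
      - det (mat_delete ?X 0 (Suc m)) * det (mat_delete ?X (Suc m) 0)"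
    by (rule desnanot_jacobi[of _ "Suc (Suc m)"]) simp_all
  then show ?thesis
    unfolding mat_delete_block by (simp only: mult.commute)
qed

lemma det_block_Suc_0: "det (block A p q (Suc 0)) = A $$ (p, q)"
proof -
  have "det (block A p q (Suc 0)) = block A p q (Suc 0) $$ (0, 0)"
    by (rule det_single) simp
  then show ?thesis by (simp add: block_def)
qed

section \<open>Correctness of the condensation while no divisor vanishes\<close>

lemma dodgson_step_carrier:
  assumes A: "A \<in> carrier_mat n n"
  shows "dodgson_step A s \<in> carrier_mat (n - s) (n - s)"
proof (induction s rule: induct_nat_012)
  case (ge2 s)
  then show ?case
    by (auto simp: consecutive_minors_def entrywise_divide_def)
qed (use A in \<open>simp_all add: consecutive_minors_def\<close>)

text \<open>Step \<open>s\<close> supplies the divisors for the matrix of size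
  \<open>n - s - 2\<close>, which must be at least \<open>k\<close>.\<close>

lemma dodgson_producesD:
  assumes A: "A \<in> carrier_mat n n" and "dodgson_produces A k"
    and "p + s + 2 < n" and "q + s + 2 < n" and "s + k + 2 \<le> n"
  shows "dodgson_step A s $$ (Suc p, Suc q) \<noteq> 0"
proof -
  have "interior_mat (dodgson A (n - s - 2 + 2)) $$ (p, q) \<noteq> 0"
  proof -
    have "k \<le> n - s - 2" "n - s - 2 + 2 \<le> dim_row A" "p < n - s - 2" "q < n - s - 2"
      using assms by auto
    then show ?thesis
      using assms(2) unfolding dodgson_produces_def by blast
  qed
  moreover have "dodgson A (n - s - 2 + 2) = dodgson_step A s"
  proof -
    have "dim_row A - (n - s - 2 + 2) = s"
      using assms by auto
    then show ?thesis
      by (simp only: dodgson_def)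
  qed
  ultimately show ?thesis
    using dodgson_step_carrier[OF A, of s] assms by (simp add: interior_mat_def)
qed

lemma dodgson_step_eq_det:
  assumes A: "A \<in> carrier_mat n n" and "dodgson_produces A k"
    and "s + k \<le> n" and "p + s < n" and "q + s < n"
  shows "dodgson_step A s $$ (p, q) = det (block A p q (Suc s))"
  using assms(3-)
proof (induction s arbitrary: p q rule: less_induct)
  case (less s)
  \<comment> \<open>The recursion reaches back two steps, and the first condensation does not
    divide.\<close>
  consider "s = 0" | "s = 1" | t where "s = Suc (Suc t)"
    by (metis One_nat_def not0_implies_Suc)
  then show ?case
  proof cases
    case 1
    then show ?thesis by (simp add: det_block_Suc_0)
  next
    case 2
    have "dodgson_step A 1 $$ (p, q)
      = A $$ (p, q) * A $$ (Suc p, Suc q) - A $$ (Suc p, q) * A $$ (p, Suc q)"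
      using less.prems A 2 by (simp add: consecutive_minors_def)
    \<comment> \<open>The empty minor, equal to 1, stands in for the missing divisor.\<close>
    also have "\<dots> = det (block A p q (Suc (Suc 0))) * det (block A (Suc p) (Suc q) 0)"
      unfolding dodgson_condensation det_block_Suc_0 ..
    also have "det (block A (Suc p) (Suc q) 0) = 1"
      by (rule det_dim_zero) simp
    finally show ?thesis
      by (simp add: 2)
  next
    case (3 t)
    let ?X = "dodgson_step A (Suc t)"
    have X: "?X \<in> carrier_mat (n - Suc t) (n - Suc t)"
      and Y: "dodgson_step A t \<in> carrier_mat (n - t) (n - t)"
      using dodgson_step_carrier[OF A] by auto
    have IH: "?X $$ (x, y) = det (block A x y (Suc (Suc t)))"
      if "x \<le> Suc p" "y \<le> Suc q" for x y
      by (rule less.IH) (use less.prems that 3 in auto)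
    have IH': "dodgson_step A t $$ (Suc p, Suc q) = det (block A (Suc p) (Suc q) (Suc t))"
      by (rule less.IH) (use less.prems 3 in auto)
    \<comment> \<open>By induction the central minor is the divisor used in this very step.\<close>
    have nz: "det (block A (Suc p) (Suc q) (Suc t)) \<noteq> 0"
      unfolding IH'[symmetric]
      by (rule dodgson_producesD[OF A assms(2)]) (use less.prems 3 in auto)
    have "dodgson_step A s $$ (p, q)
      = (?X $$ (p, q) * ?X $$ (Suc p, Suc q) - ?X $$ (Suc p, q) * ?X $$ (p, Suc q))
        / dodgson_step A t $$ (Suc p, Suc q)"
      using X Y less.prems 3
      by (simp add: entrywise_divide_def consecutive_minors_def interior_mat_def)
    also have "\<dots> = det (block A p q (Suc (Suc (Suc t)))) * det (block A (Suc p) (Suc q) (Suc t))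
        / det (block A (Suc p) (Suc q) (Suc t))"
      unfolding dodgson_condensation by (simp only: IH IH' le_refl le_SucI)
    also have "\<dots> = det (block A p q (Suc s))"
      unfolding 3 by (rule nonzero_mult_div_cancel_right[OF nz])
    finally show ?thesis .
  qed
qed

section \<open>Recovering the entry beyond the zero\<close>

lemma det_2_rows_list:
  "det (mat_of_rows_list 2 [[a, b], [c, d]]) = a * d - b * (c :: 'a :: comm_ring_1)"
proof -
  let ?M = "mat_of_rows_list 2 [[a, b], [c, d]]"
  have M: "?M \<in> carrier_mat (Suc (Suc 0)) (Suc (Suc 0))"
    by (simp add: mat_of_rows_list_def numeral_2_eq_2)
  show ?thesis
    using laplace_expansion_column[OF M, of 0]
    by (simp add: cofactor_def det_single mat_delete_def mat_of_rows_list_def numeral_2_eq_2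
        algebra_simps)
qed

theorem theorem2p3:
  fixes A M' \<A> :: "'a::field mat" and \<alpha> :: 'a and n k i j l :: nat
  assumes "A \<in> carrier_mat n n"
    and "3 \<le> k" and "k \<le> n"
    and "dodgson_produces A k"
    and "2 \<le> i" and "i \<le> k - 1" and "2 \<le> j" and "j \<le> k - 1"
    and "dodgson A k $$ (i - 1, j - 1) = 0"
    and "\<alpha> = dodgson A k $$ (i - 2, j - 1)" and "\<alpha> \<noteq> 0"
    and "l = n - k"
    and "\<A> = submatrix A {i - 2..i + l} {j - 2..j + l}"
    and "M' = mat_of_rows_list 2
           [[entry_minor \<A> (l + 1) 0, entry_minor \<A> (l + 1) (l + 2)],
            [entry_minor \<A> (l + 2) 0, entry_minor \<A> (l + 2) (l + 2)]]"
  shows "det M' / \<alpha> = det \<A> \<and>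
    (\<forall>A' :: 'a mat. A' \<in> carrier_mat n n \<and> dodgson_produces A' (k - 2) \<longrightarrow>
       dodgson A' (k - 2) $$ (i - 2, j - 2) = det (submatrix A' {i - 2..i + l} {j - 2..j + l}))"
proof -
  obtain p where i: "i = p + 2"
    using \<open>2 \<le> i\<close> by (metis le_add_diff_inverse2)
  obtain q where j: "j = q + 2"
    using \<open>2 \<le> j\<close> by (metis le_add_diff_inverse2)
  \<comment> \<open>From \<open>i \<le> k - 1\<close> and \<open>l = n - k\<close>:
    \<open>\<A>\<close> lies inside \<open>A\<close>, its upper left corner being
    \<open>(p, q)\<close> when counted from 0.\<close>
  have pq: "p + l + 3 \<le> n" "q + l + 3 \<le> n"
    using assms(2,3,6,8,12) by (auto simp: i j)
  have sub: "submatrix X {i - 2..i + l} {j - 2..j + l} = block X p q (l + 3)"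
    if "X \<in> carrier_mat n n" for X :: "'a mat"
  proof -
    have "{i - 2..i + l} = {p..<p + (l + 3)}" "{j - 2..j + l} = {q..<q + (l + 3)}"
      by (auto simp: i j)
    then show ?thesis
      using submatrix_eq_block[of p "l + 3" X q] pq that by simp
  qed
  have \<A>: "\<A> = block A p q (l + 3)"
    using sub[OF assms(1)] assms(13) by simp
  have \<alpha>: "\<alpha> = det (block A p (Suc q) (l + 1))"
    using dodgson_step_eq_det[OF assms(1,4), of l p "Suc q"] assms(1,3,10,12) pq
    by (simp add: dodgson_def i j)
  \<comment> \<open>The last two rows with the first and last columns are the lines through the
    entries of the complementary 2 by 2 matrix.\<close>
  have "det M' = det \<A> * det (mat_delete (mat_delete \<A> (l + 2) (l + 2)) (l + 1) 0)"
    using desnanot_jacobi[of \<A> "l + 3" "l + 1" "l + 2" 0 "l + 2"]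
    unfolding assms(14) det_2_rows_list entry_minor_def by (simp add: \<A>)
  \<comment> \<open>After the last row and column are gone, row \<open>l + 1\<close> is the last one
    left; the remaining block is the one whose determinant is \<open>\<alpha>\<close>.\<close>
  also have "mat_delete (mat_delete \<A> (l + 2) (l + 2)) (l + 1) 0 = block A p (Suc q) (l + 1)"
    using mat_delete_block(4)[of A p q "l + 2"] mat_delete_block(3)[of A p q "l + 1"]
    by (simp add: \<A> numeral_eq_Suc)
  finally have "det M' / \<alpha> = det \<A>"
    using \<open>\<alpha> \<noteq> 0\<close> by (simp add: \<alpha>)
  \<comment> \<open>The run on \<open>A\<close> itself stops at the zero, so the value of a
    successful run is expressed through matrices \<open>A'\<close> for which no divisor
    vanishes.\<close>
  moreover have "dodgson A' (k - 2) $$ (i - 2, j - 2) = det (submatrix A' {i - 2..i + l} {j - 2..j + l})"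
    if A': "A' \<in> carrier_mat n n" "dodgson_produces A' (k - 2)" for A' :: "'a mat"
  proof -
    have "n - (k - 2) = l + 2" using assms(2,3,12) by simp
    then have "dodgson A' (k - 2) $$ (i - 2, j - 2) = det (block A' p q (Suc (l + 2)))"
      using dodgson_step_eq_det[OF A', of "l + 2" p q] A' assms(2,3,12) pq
      by (simp add: dodgson_def i j)
    also have "block A' p q (Suc (l + 2)) = submatrix A' {i - 2..i + l} {j - 2..j + l}"
      unfolding sub[OF A'(1)] by (simp add: numeral_eq_Suc)
    finally show ?thesis .
  qed
  ultimately show ?thesis by blast
qed

end
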